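(* For all integers $0\le m<n$, $$d_{\mathrm{GH}}^{\mathbb Z_2}(\mathbb S^m_\infty,\mathbb S^n_\infty)\ \ge\ \frac{1}{\sqrt{m+1}}.$$
   Context: $\mathbb S^n_\infty$ is the usual round unit sphere $\{x\in\mathbb R^{n+1}:\sum_i x_i^2=1\}$ with the metric induced by the $\ell^\infty$-norm of $\mathbb R^{n+1}$ and the $\mathbb Z_2$-action $u\mapsto-u$. For metric spaces $X,Y$ with isometric $\mathbb Z_2$-actions generated by involutions $\tau_X,\tau_Y$, $d_{\mathrm{GH}}^{\mathbb Z_2}(X,Y):=\frac12\inf_R\sup_{(x,y),(x',y')\in R}|d_X(x,x')-d_Y(y,y')|$, the infimum over all sets $R\subseteq X\times Y$ projecting onto $X$ and onto $Y$ such that $(\tau_X(x),\tau_Y(y))\in R$ whenever $(x,y)\in R$. *)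

theory Defs
  imports "HOL-Analysis.Analysis"
begin

section \<open>Isometric \<open>\<int>\<^sub>2\<close>-actions and the equivariant Gromov--Hausdorff distance\<close>

definition isometric_involution :: "'a metric \<Rightarrow> ('a \<Rightarrow> 'a) \<Rightarrow> bool" where
  "isometric_involution X \<tau> \<longleftrightarrow>
     (\<forall>x\<in>mspace X. \<tau> x \<in> mspace X \<and> \<tau> (\<tau> x) = x) \<and>
     (\<forall>x\<in>mspace X. \<forall>y\<in>mspace X. mdist X (\<tau> x) (\<tau> y) = mdist X x y)"

definition z2_correspondences ::
  "'a metric \<Rightarrow> ('a \<Rightarrow> 'a) \<Rightarrow> 'b metric \<Rightarrow> ('b \<Rightarrow> 'b) \<Rightarrow> ('a \<times> 'b) set set" where
  "z2_correspondences X \<tau>X Y \<tau>Y =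
     {R. R \<subseteq> mspace X \<times> mspace Y \<and> fst ` R = mspace X \<and> snd ` R = mspace Y \<and>
         (\<forall>(x, y)\<in>R. (\<tau>X x, \<tau>Y y) \<in> R)}"

text \<open>
  The distortion and the distance take values in \<^typ>\<open>ennreal\<close>: for unbounded metric spaces the
  supremum may be infinite, and there may be no correspondence at all if exactly one of the spaces is empty.
\<close>

definition distortion :: "'a metric \<Rightarrow> 'b metric \<Rightarrow> ('a \<times> 'b) set \<Rightarrow> ennreal" where
  "distortion X Y R =
     (SUP (p, q)\<in>R \<times> R. ennreal \<bar>mdist X (fst p) (fst q) - mdist Y (snd p) (snd q)\<bar>)"

definition GH_dist_Z2 ::
  "'a metric \<Rightarrow> ('a \<Rightarrow> 'a) \<Rightarrow> 'b metric \<Rightarrow> ('b \<Rightarrow> 'b) \<Rightarrow> ennreal" where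
  "GH_dist_Z2 X \<tau>X Y \<tau>Y = (1 / 2) * (INF R\<in>z2_correspondences X \<tau>X Y \<tau>Y. distortion X Y R)"


section \<open>Round spheres with the \<open>\<ell>\<^sup>\<infinity>\<close> metric\<close>

text \<open>
  A point of \<open>\<real>\<^sup>n\<^sup>+\<^sup>1\<close> is a function \<^typ>\<open>nat \<Rightarrow> real\<close> vanishing at all indices above \<open>n\<close>;
  this is the convention of \<^const>\<open>nsphere\<close>, whose points are the unit vectors for the Euclidean norm.
\<close>

definition linf_dist :: "nat \<Rightarrow> (nat \<Rightarrow> real) \<Rightarrow> (nat \<Rightarrow> real) \<Rightarrow> real" where
  "linf_dist n x y = Max ((\<lambda>i. \<bar>x i - y i\<bar>) ` {..n})"

definition linf_sphere :: "nat \<Rightarrow> (nat \<Rightarrow> real) metric" where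
  "linf_sphere n = metric (topspace (nsphere n), linf_dist n)"

definition antipode :: "(nat \<Rightarrow> real) \<Rightarrow> (nat \<Rightarrow> real)" where
  "antipode u = (\<lambda>i. - u i)"

lemma topspace_nsphere:
  "topspace (nsphere n) = {x. (\<Sum>i\<le>n. (x i)\<^sup>2) = 1 \<and> (\<forall>i>n. x i = 0)}"
  by (simp add: nsphere)

lemma linf_dist_ge: "i \<le> n \<Longrightarrow> \<bar>x i - y i\<bar> \<le> linf_dist n x y"
  unfolding linf_dist_def by (intro Max_ge) auto

lemma linf_dist_le_iff: "linf_dist n x y \<le> c \<longleftrightarrow> (\<forall>i\<le>n. \<bar>x i - y i\<bar> \<le> c)"
  unfolding linf_dist_def by (subst Max_le_iff) auto

lemma Metric_space_linf: "Metric_space (topspace (nsphere n)) (linf_dist n)"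
proof
  fix x y :: "nat \<Rightarrow> real"
  show "0 \<le> linf_dist n x y"
    using linf_dist_ge[of 0 n x y] by linarith
  show "linf_dist n x y = linf_dist n y x"
    by (simp add: linf_dist_def abs_minus_commute)
next
  fix x y :: "nat \<Rightarrow> real"
  assume xy: "x \<in> topspace (nsphere n)" "y \<in> topspace (nsphere n)"
  show "linf_dist n x y = 0 \<longleftrightarrow> x = y"
  proof
    assume "linf_dist n x y = 0"
    then have "\<forall>i\<le>n. x i = y i"
      using linf_dist_le_iff[of n x y 0] by simp
    moreover have "\<forall>i>n. x i = y i"
      using xy by (simp add: topspace_nsphere)
    ultimately show "x = y"
      by (metis ext not_le)
  next
    assume "x = y"
    then show "linf_dist n x y = 0"
      using linf_dist_le_iff[of n x y 0] linf_dist_ge[of 0 n x y] by simp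
  qed
next
  fix x y z :: "nat \<Rightarrow> real"
  have "\<bar>x i - z i\<bar> \<le> linf_dist n x y + linf_dist n y z" if "i \<le> n" for i
    using linf_dist_ge[OF that, of x y] linf_dist_ge[OF that, of y z] by linarith
  then show "linf_dist n x z \<le> linf_dist n x y + linf_dist n y z"
    by (simp add: linf_dist_le_iff)
qed

lemma mspace_linf_sphere [simp]: "mspace (linf_sphere n) = topspace (nsphere n)"
  and mdist_linf_sphere [simp]: "mdist (linf_sphere n) = linf_dist n"
  using Metric_space_linf[of n]
  by (simp_all add: linf_sphere_def Metric_space.mspace_metric Metric_space.mdist_metric)

lemma isometric_involution_antipode: "isometric_involution (linf_sphere n) antipode"
proof -
  have "\<bar>y i - x i\<bar> = \<bar>x i - y i\<bar>" for x y :: "nat \<Rightarrow> real" and i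
    by (rule abs_minus_commute)
  then show ?thesis
    by (simp add: isometric_involution_def antipode_def topspace_nsphere linf_dist_def)
qed

end

theory Submission
  imports Defs "HOL-Homology.Brouwer_Degree"
begin

text \<open>
  Put \<open>r = 1 / sqrt (m + 1)\<close>. Every point of the \<open>m\<close>-sphere has a coordinate of absolute value at least
  \<open>r\<close>, and two points with \<open>x\<^sub>i \<ge> r\<close> and \<open>x'\<^sub>i \<le> -r\<close> have distance at least \<open>2 r\<close>. Given an equivariant
  correspondence \<open>R\<close>, let \<open>A\<^sub>i\<close> (for \<open>i \<le> m\<close>) be the set of points \<open>y\<close> of the \<open>n\<close>-sphere that correspond
  to some \<open>x\<close> with \<open>x\<^sub>i \<ge> r\<close>. Then \<open>A\<^sub>0, \<dots>, A\<^sub>m\<close> and their antipodal images cover the \<open>n\<close>-sphere. If the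
  distortion of \<open>R\<close> were less than \<open>2 r\<close>, each \<open>A\<^sub>i\<close> would be at positive distance from \<open>-A\<^sub>i\<close>. By a
  theorem of Lusternik and Schnirelmann, equivalent to the Borsuk--Ulam theorem, this takes at least
  \<open>n + 1\<close> sets, whereas there are only \<open>m + 1 \<le> n\<close> of them (\<open>antipodal_sets_come_close\<close>).

  The topological input is \<open>open_cover_meets_both_sides\<close>, a cup length argument. Let \<open>\<tau>\<close> be the
  antipodal involution and let \<open>s\<^sub>0, \<dots>, s\<^bsub>n-1\<^esub>\<close> be arbitrary, possibly discontinuous, functions with
  values in \<open>{0, 1}\<close> and \<open>s\<^sub>i \<circ> \<tau> = 1 - s\<^sub>i\<close>. Modulo 2, the coboundary of each \<open>s\<^sub>i\<close> descends to the
  quotient by \<open>\<tau>\<close>, where it represents the class \<open>w\<close> of the double cover. In projective space \<open>w\<^sup>n\<close> is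
  not zero. Concretely, the vanishing of the homology of the sphere below degree \<open>n\<close> yields singular
  chains \<open>c\<^sub>0, \<dots>, c\<^sub>n\<close>, with \<open>c\<^sub>0\<close> a point and \<open>\<partial>c\<^bsub>p+1\<^esub> = c\<^sub>p \<plusminus> \<tau> c\<^sub>p\<close>, which model the cells of projective
  space, and the product \<open>\<delta>s\<^sub>0 \<union> \<dots> \<union> \<delta>s\<^bsub>n-1\<^esub>\<close> takes an odd value on \<open>c\<^sub>n\<close>
  (\<open>odd_eval_antipodal_chains\<close>). Barycentric subdivision preserves these relations, so the simplices of
  \<open>c\<^sub>n\<close> may be taken as small as desired, and then some small simplex has a nonzero product; none of the
  functions \<open>s\<^sub>i\<close> is constant on it. In the application \<open>s\<^sub>i\<close> is 1 near \<open>A\<^sub>i\<close> and 0 near \<open>-A\<^sub>i\<close>, so every small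
  set has some constant \<open>s\<^sub>i\<close>, a contradiction.
\<close>

section \<open>Cochains on vertex sequences\<close>

text \<open>
  The value of the cup product \<open>\<delta>s\<^sub>0 \<union> \<dots> \<union> \<delta>s\<^bsub>p-1\<^esub>\<close> on a simplex with vertices \<open>v\<^sub>0, \<dots>, v\<^sub>p\<close>. Vertices form
  an infinite sequence of which only the initial part matters, so that faces of all dimensions have the
  same type.
\<close>

definition cup_coboundaries :: "(nat \<Rightarrow> 'a \<Rightarrow> int) \<Rightarrow> nat \<Rightarrow> (nat \<Rightarrow> 'a) \<Rightarrow> int" where
  "cup_coboundaries s p v = (\<Prod>i<p. s i (v (Suc i)) - s i (v i))"

text \<open>
  The cup product \<open>s\<^sub>0 \<union> \<delta>s\<^sub>1 \<union> \<dots> \<union> \<delta>s\<^sub>p\<close>.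
\<close>

definition cup_primitive :: "(nat \<Rightarrow> 'a \<Rightarrow> int) \<Rightarrow> nat \<Rightarrow> (nat \<Rightarrow> 'a) \<Rightarrow> int" where
  "cup_primitive s p v = s 0 (v 0) * cup_coboundaries (\<lambda>i. s (Suc i)) p v"

definition omit :: "nat \<Rightarrow> (nat \<Rightarrow> 'a) \<Rightarrow> nat \<Rightarrow> 'a" where
  "omit k v i = (if i < k then v i else v (Suc i))"

lemma cup_coboundaries_cong:
  "(\<And>i. i \<le> p \<Longrightarrow> v i = w i) \<Longrightarrow> cup_coboundaries s p v = cup_coboundaries s p w"
  unfolding cup_coboundaries_def by (intro prod.cong) auto

lemma cup_primitive_cong:
  "(\<And>i. i \<le> p \<Longrightarrow> v i = w i) \<Longrightarrow> cup_primitive s p v = cup_primitive s p w"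
  unfolding cup_primitive_def by (metis cup_coboundaries_cong le0)

text \<open>
  Since \<open>\<delta>\<delta> = 0\<close>, the Leibniz rule gives \<open>\<delta>(s\<^sub>0 \<union> \<delta>s\<^sub>1 \<union> \<dots> \<union> \<delta>s\<^sub>p) = \<delta>s\<^sub>0 \<union> \<dots> \<union> \<delta>s\<^sub>p\<close>. In the induction the last
  factor is split off: it is the same for all faces except the last two, and these combine to it.
\<close>

lemma coboundary_cup_primitive:
  "(\<Sum>k\<le>Suc p. (-1) ^ k * cup_primitive s p (omit k v)) = cup_coboundaries s (Suc p) v"
proof (induction p)
  case 0
  show ?case
    by (simp add: cup_primitive_def cup_coboundaries_def omit_def)
next
  case (Suc p)
  let ?P = "cup_primitive s"
  let ?s = "s (Suc p)"
  have step: "?P (Suc p) w = ?P p w * (?s (w (Suc p)) - ?s (w p))" for w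
    by (simp add: cup_primitive_def cup_coboundaries_def)
  \<comment> \<open>Omitting an early vertex does not affect the last factor.\<close>
  have low: "?P (Suc p) (omit k v) = ?P p (omit k v) * (?s (v (Suc (Suc p))) - ?s (v (Suc p)))"
    if "k \<le> p" for k
    using that by (simp add: step omit_def)
  have last: "?P p (omit (Suc p) v) = ?P p v" "?P p (omit (Suc (Suc p)) v) = ?P p v"
    by (rule cup_primitive_cong; simp add: omit_def)+
  have mid: "?P (Suc p) (omit (Suc p) v) = ?P p v * (?s (v (Suc (Suc p))) - ?s (v p))"
    using last by (simp add: step omit_def)
  have top: "?P (Suc p) (omit (Suc (Suc p)) v) = ?P p v * (?s (v (Suc p)) - ?s (v p))"
    using last by (simp add: step omit_def)
  have "(\<Sum>k\<le>Suc (Suc p). (-1) ^ k * ?P (Suc p) (omit k v)) =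
      (\<Sum>k\<le>p. (-1) ^ k * ?P p (omit k v)) * (?s (v (Suc (Suc p))) - ?s (v (Suc p)))
      + (-1) ^ Suc p * ?P (Suc p) (omit (Suc p) v)
      + (-1) ^ Suc (Suc p) * ?P (Suc p) (omit (Suc (Suc p)) v)"
    by (simp add: low sum_distrib_right mult.assoc)
  also have "\<dots> = (\<Sum>k\<le>Suc p. (-1) ^ k * ?P p (omit k v)) * (?s (v (Suc (Suc p))) - ?s (v (Suc p)))"
    by (simp add: mid top last algebra_simps)
  also have "\<dots> = cup_coboundaries s (Suc (Suc p)) v"
    by (simp only: Suc.IH) (simp add: cup_coboundaries_def)
  finally show ?case .
qed

lemma cup_coboundaries_antisymmetric:
  assumes "\<And>i j. i < p \<Longrightarrow> j \<le> p \<Longrightarrow> s i (w j) = 1 - s i (v j)"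
  shows "cup_coboundaries s p w = (-1) ^ p * cup_coboundaries s p v"
proof -
  have "cup_coboundaries s p w = (\<Prod>i<p. (-1) * (s i (v (Suc i)) - s i (v i)))"
    unfolding cup_coboundaries_def by (intro prod.cong) (auto simp: assms)
  also have "\<dots> = (-1) ^ p * cup_coboundaries s p v"
    unfolding prod.distrib cup_coboundaries_def by simp
  finally show ?thesis .
qed

text \<open>
  This is the step that lowers the degree: for \<open>\<phi> = s\<^sub>0 \<union> \<delta>s\<^sub>1 \<union> \<dots> \<union> \<delta>s\<^sub>p\<close> it says, up to signs, that
  \<open>\<phi> + \<tau>\<^sup>*\<phi>\<close> is \<open>\<delta>s\<^sub>1 \<union> \<dots> \<union> \<delta>s\<^sub>p\<close>, because \<open>s\<^sub>0 + \<tau>\<^sup>*s\<^sub>0 = 1\<close>.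
\<close>

lemma cup_primitive_antisymmetric:
  assumes "\<And>i j. i \<le> p \<Longrightarrow> j \<le> p \<Longrightarrow> s i (w j) = 1 - s i (v j)"
  shows "cup_primitive s p w =
    (-1) ^ p * (cup_coboundaries (\<lambda>i. s (Suc i)) p v - cup_primitive s p v)"
proof -
  have "s 0 (w 0) = 1 - s 0 (v 0)"
    using assms by simp
  moreover have "cup_coboundaries (\<lambda>i. s (Suc i)) p w =
      (-1) ^ p * cup_coboundaries (\<lambda>i. s (Suc i)) p v"
    using assms by (intro cup_coboundaries_antisymmetric) simp
  ultimately show ?thesis
    unfolding cup_primitive_def by (simp only:) (simp add: algebra_simps)
qed

section \<open>Evaluating cochains on singular chains\<close>

definition simplex_vertices :: "((nat \<Rightarrow> real) \<Rightarrow> 'a) \<Rightarrow> nat \<Rightarrow> 'a" where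
  "simplex_vertices f i = f (\<lambda>j. if j = i then 1 else 0)"

lemma simplex_vertices_simplex_map:
  "i \<le> p \<Longrightarrow> simplex_vertices (simplex_map p g f) i = g (simplex_vertices f i)"
  by (simp add: simplex_vertices_def simplex_map_def)

lemma simplex_vertices_singular_face:
  assumes "i \<le> p"
  shows "simplex_vertices (singular_face (Suc p) k f) i = omit k (simplex_vertices f) i"
proof -
  have "simplical_face k (\<lambda>j. if j = i then 1 else 0 :: real) =
      (\<lambda>j. if j = (if i < k then i else Suc i) then 1 else 0)"
    by (auto simp: simplical_face_def fun_eq_iff)
  then show ?thesis
    using assms by (simp add: simplex_vertices_def singular_face_def omit_def)
qed

lemma simplex_vertices_in_image:
  "i \<le> p \<Longrightarrow> f \<in> standard_simplex p \<rightarrow> V \<Longrightarrow> simplex_vertices f i \<in> V"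
  by (auto simp: simplex_vertices_def)

text \<open>
  The linear extension of \<open>\<phi>\<close> to chains. The free abelian group on a single generator stands for the
  integers, so that the rules for \<^const>\<open>frag_extend\<close> apply.
\<close>

definition eval_cochain :: "('b \<Rightarrow> int) \<Rightarrow> ('b \<Rightarrow>\<^sub>0 int) \<Rightarrow> int" where
  "eval_cochain \<phi> c =
    poly_mapping.lookup (frag_extend (\<lambda>f. frag_cmul (\<phi> f) (frag_of ())) c) ()"

lemma eval_cochain_zero [simp]: "eval_cochain \<phi> 0 = 0"
  by (simp add: eval_cochain_def)

lemma eval_cochain_of [simp]: "eval_cochain \<phi> (frag_of f) = \<phi> f"
  by (simp add: eval_cochain_def)

lemma eval_cochain_add: "eval_cochain \<phi> (a + b) = eval_cochain \<phi> a + eval_cochain \<phi> b"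
  by (simp add: eval_cochain_def frag_extend_add lookup_add)

lemma eval_cochain_diff: "eval_cochain \<phi> (a - b) = eval_cochain \<phi> a - eval_cochain \<phi> b"
  by (simp add: eval_cochain_def frag_extend_diff lookup_minus)

lemma eval_cochain_cmul: "eval_cochain \<phi> (frag_cmul k a) = k * eval_cochain \<phi> a"
  by (simp add: eval_cochain_def frag_extend_cmul)

lemma eval_cochain_sum: "eval_cochain \<phi> (sum g I) = (\<Sum>i\<in>I. eval_cochain \<phi> (g i))"
  by (induction I rule: infinite_finite_induct) (simp_all add: eval_cochain_add)

lemma eval_cochain_cong:
  assumes "\<And>f. f \<in> Poly_Mapping.keys c \<Longrightarrow> \<phi> f = \<psi> f"
  shows "eval_cochain \<phi> c = eval_cochain \<psi> c"
  unfolding eval_cochain_def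
  by (rule arg_cong[of _ _ "\<lambda>c. poly_mapping.lookup c ()"], rule frag_extend_eq) (simp add: assms)

lemma eval_cochain_eq_0:
  "(\<And>f. f \<in> Poly_Mapping.keys c \<Longrightarrow> \<phi> f = 0) \<Longrightarrow> eval_cochain \<phi> c = 0"
  by (simp add: eval_cochain_def frag_extend_eq_0)

lemma eval_cochain_linear:
  "eval_cochain (\<lambda>f. a * \<phi> f + b * \<psi> f) c = a * eval_cochain \<phi> c + b * eval_cochain \<psi> c"
  using subset_UNIV
  by (induction c rule: frag_induction) (simp_all add: eval_cochain_diff algebra_simps)

lemma eval_cochain_chain_map:
  "eval_cochain \<phi> (chain_map p g c) = eval_cochain (\<lambda>f. \<phi> (simplex_map p g f)) c"
  using subset_UNIV
  by (induction c rule: frag_induction) (simp_all add: eval_cochain_diff chain_map_diff)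

lemma eval_cochain_boundary:
  "eval_cochain \<phi> (chain_boundary (Suc p) c) =
   eval_cochain (\<lambda>f. \<Sum>k\<le>Suc p. (-1) ^ k * \<phi> (singular_face (Suc p) k f)) c"
  using subset_UNIV
proof (induction c rule: frag_induction)
  case (one f)
  show ?case
    by (simp add: chain_boundary_of eval_cochain_sum eval_cochain_cmul eval_cochain_add
      del: sum.atMost_Suc)
qed (simp_all only: eval_cochain_diff chain_boundary_diff chain_boundary_0 eval_cochain_zero)

lemma eval_cup_primitive_boundary:
  "eval_cochain (\<lambda>f. cup_primitive s p (simplex_vertices f)) (chain_boundary (Suc p) c) =
   eval_cochain (\<lambda>f. cup_coboundaries s (Suc p) (simplex_vertices f)) c"
proof -
  have "cup_primitive s p (simplex_vertices (singular_face (Suc p) k f)) =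
      cup_primitive s p (omit k (simplex_vertices f))" for k f
    by (rule cup_primitive_cong) (rule simplex_vertices_singular_face)
  then show ?thesis
    unfolding eval_cochain_boundary coboundary_cup_primitive[symmetric] by (simp only:)
qed

section \<open>Antipodal chains\<close>

text \<open>
  The sign is the one that makes \<open>c\<^sub>p \<plusminus> \<tau> c\<^sub>p\<close> a cycle. For the sphere, \<open>c\<^sub>p\<close> behaves like a hemisphere of the
  standard \<open>p\<close>-sphere, whose boundary consists of two opposite hemispheres one dimension lower.
\<close>

definition antipodal_chains ::
    "'a topology \<Rightarrow> ('a \<Rightarrow> 'a) \<Rightarrow> nat \<Rightarrow> (nat \<Rightarrow> 'a chain) \<Rightarrow> bool" where
  "antipodal_chains X \<tau> n c \<longleftrightarrow>
     (\<exists>f. c 0 = frag_of f) \<and> (\<forall>p\<le>n. singular_chain p X (c p)) \<and>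
     (\<forall>p<n. chain_boundary (Suc p) (c (Suc p)) =
              c p + frag_cmul ((-1) ^ Suc p) (chain_map p \<tau> (c p)))"

text \<open>
  Let \<open>\<phi> = s\<^sub>0 \<union> \<delta>s\<^sub>1 \<union> \<dots> \<union> \<delta>s\<^sub>p\<close>. The value of \<open>\<delta>s\<^sub>0 \<union> \<dots> \<union> \<delta>s\<^sub>p = \<delta>\<phi>\<close> on \<open>c\<^bsub>p+1\<^esub>\<close> is the value of \<open>\<phi>\<close> on
  \<open>c\<^sub>p \<plusminus> \<tau> c\<^sub>p\<close>, which is congruent modulo 2 to that of \<open>\<delta>s\<^sub>1 \<union> \<dots> \<union> \<delta>s\<^sub>p\<close> on \<open>c\<^sub>p\<close>. Induction, for all
  sequences \<open>s\<close> at once, ends with the empty product on the single point \<open>c\<^sub>0\<close>, which is 1.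
\<close>

lemma odd_eval_antipodal_chains:
  fixes s :: "nat \<Rightarrow> 'a \<Rightarrow> int"
  assumes c: "antipodal_chains X \<tau> n c" and "p \<le> n"
    and s: "\<And>i x. i < p \<Longrightarrow> x \<in> topspace X \<Longrightarrow> s i (\<tau> x) = 1 - s i x"
  shows "odd (eval_cochain (\<lambda>f. cup_coboundaries s p (simplex_vertices f)) (c p))"
  using \<open>p \<le> n\<close> s
proof (induction p arbitrary: s)
  case 0
  then show ?case
    using c by (auto simp: antipodal_chains_def cup_coboundaries_def)
next
  case (Suc p)
  let ?P = "\<lambda>f. cup_primitive s p (simplex_vertices f)"
  let ?D = "\<lambda>f. cup_coboundaries (\<lambda>i. s (Suc i)) p (simplex_vertices f)"
  have IH: "odd (eval_cochain ?D (c p))"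
    using Suc by simp
  have "?P (simplex_map p \<tau> f) = (-1) ^ p * ?D f + (- ((-1) ^ p)) * ?P f"
    if "f \<in> Poly_Mapping.keys (c p)" for f
  proof -
    have "singular_chain p X (c p)"
      using c Suc.prems(1) by (simp add: antipodal_chains_def)
    then have "singular_simplex p X f"
      using that by (auto simp: singular_chain_def)
    then have "f \<in> standard_simplex p \<rightarrow> topspace X"
      using continuous_map_funspace[of "subtopology (powertop_real UNIV) (standard_simplex p)" X f]
      by (simp add: singular_simplex_def topspace_standard_simplex)
    then have "s i (simplex_vertices (simplex_map p \<tau> f) j) = 1 - s i (simplex_vertices f j)"
      if "i \<le> p" "j \<le> p" for i j
      using that simplex_vertices_in_image[of j p f "topspace X"]
      by (simp add: simplex_vertices_simplex_map Suc.prems)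
    then show ?thesis
      by (subst cup_primitive_antisymmetric[where v = "simplex_vertices f"])
        (auto simp: algebra_simps)
  qed
  then have "eval_cochain ?P (chain_map p \<tau> (c p)) =
      (-1) ^ p * eval_cochain ?D (c p) + (- ((-1) ^ p)) * eval_cochain ?P (c p)"
    unfolding eval_cochain_chain_map eval_cochain_linear[symmetric] by (rule eval_cochain_cong)
  then have "(-1) ^ p * eval_cochain ?P (chain_map p \<tau> (c p)) =
      (-1) ^ p * (-1) ^ p * (eval_cochain ?D (c p) - eval_cochain ?P (c p))"
    by (simp only:) (simp add: algebra_simps)
  then have "(-1) ^ p * eval_cochain ?P (chain_map p \<tau> (c p)) =
      eval_cochain ?D (c p) - eval_cochain ?P (c p)"
    by (simp flip: power_mult_distrib)
  moreover have "chain_boundary (Suc p) (c (Suc p)) =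
      c p + frag_cmul ((-1) ^ Suc p) (chain_map p \<tau> (c p))"
    using c Suc.prems(1) by (auto simp: antipodal_chains_def)
  ultimately have "eval_cochain (\<lambda>f. cup_coboundaries s (Suc p) (simplex_vertices f)) (c (Suc p))
      = 2 * eval_cochain ?P (c p) - eval_cochain ?D (c p)"
    unfolding eval_cup_primitive_boundary[symmetric]
    by (simp add: eval_cochain_add eval_cochain_cmul)
  then show ?case
    using IH by simp
qed

lemma antipodal_chains_subdivision:
  assumes "antipodal_chains X \<tau> n c"
  shows "antipodal_chains X \<tau> n (\<lambda>p. singular_subdivision p (c p))"
  unfolding antipodal_chains_def
proof (intro conjI allI impI)
  show "\<exists>f. singular_subdivision 0 (c 0) = frag_of f"
    using assms singular_subdivision_zero[of X "c 0"] by (auto simp: antipodal_chains_def)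
next
  fix p
  assume "p \<le> n"
  then show "singular_chain p X (singular_subdivision p (c p))"
    using assms by (simp add: antipodal_chains_def singular_chain_singular_subdivision)
next
  fix p
  assume "p < n"
  then have ch: "singular_chain (Suc p) X (c (Suc p))" "singular_chain p X (c p)"
    and bd: "chain_boundary (Suc p) (c (Suc p)) =
      c p + frag_cmul ((-1) ^ Suc p) (chain_map p \<tau> (c p))"
    using assms by (auto simp: antipodal_chains_def)
  have "chain_boundary (Suc p) (singular_subdivision (Suc p) (c (Suc p))) =
      singular_subdivision p (c p + frag_cmul ((-1) ^ Suc p) (chain_map p \<tau> (c p)))"
    using chain_boundary_singular_subdivision[OF ch(1)] bd by simp
  also have "\<dots> = singular_subdivision p (c p) +
      frag_cmul ((-1) ^ Suc p) (singular_subdivision p (chain_map p \<tau> (c p)))"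
    by (simp add: singular_subdivision_def frag_extend_add frag_extend_cmul)
  finally show "chain_boundary (Suc p) (singular_subdivision (Suc p) (c (Suc p))) =
      singular_subdivision p (c p) +
      frag_cmul ((-1) ^ Suc p) (chain_map p \<tau> (singular_subdivision p (c p)))"
    by (simp add: naturality_singular_subdivision[OF ch(2)])
qed

lemma antipodal_chains_iterated_subdivision:
  assumes "antipodal_chains X \<tau> n c"
  shows "antipodal_chains X \<tau> n (\<lambda>p. (singular_subdivision p ^^ N) (c p))"
proof (induction N)
  case 0
  then show ?case using assms by simp
next
  case (Suc N)
  then show ?case using antipodal_chains_subdivision[OF Suc] by simp
qed

text \<open>
  The passage from homology groups to chains. In degree 0 the hypothesis on the map to a point says that
  the coefficients of \<open>z\<close> add up to 0.
\<close>

lemma reduced_cycle_is_boundary: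
  assumes triv: "trivial_group (reduced_homology_group (int p) X)"
    and z: "singular_chain p X z" "chain_boundary p z = 0"
    and aug: "p = 0 \<Longrightarrow> chain_map 0 (\<lambda>_. ()) z = 0"
  obtains d where "singular_chain (Suc p) X d" "chain_boundary (Suc p) d = z"
proof -
  have cyc: "singular_relcycle p X {} z"
    using z by (simp add: singular_cycle)
  let ?cl = "homologous_rel_set p X {} z"
  have mem: "?cl \<in> carrier (homology_group (int p) X)"
    using cyc by (auto simp: carrier_relative_homology_group)
  have "?cl \<in> carrier (reduced_homology_group (int p) X)"
  proof (cases "p = 0")
    case True
    have "hom_induced (int p) X {} (discrete_topology {()}) {} (\<lambda>x. ()) ?cl =
        homologous_rel_set p (discrete_topology {()}) {} (chain_map p (\<lambda>x. ()) z)"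
      using cyc by (intro hom_induced_chain_map) auto
    also have "\<dots> = \<one>\<^bsub>homology_group (int p) (discrete_topology {()})\<^esub>"
      using aug True unfolding one_relative_homology_group by (simp add: homologous_rel_def)
        (auto simp: singular_relboundary_minus)
    finally show ?thesis
      using mem by (simp add: carrier_reduced_homology_group kernel_def)
  next
    case False
    then show ?thesis using mem by (simp add: un_reduced_homology_group)
  qed
  then have "?cl = \<one>\<^bsub>homology_group (int p) X\<^esub>"
    using triv by (auto simp: trivial_group_def one_reduced_homology_group)
  then have "singular_relboundary p X {} z"
    by (metis homologous_rel_refl mem_Collect_eq one_relative_homology_group)
  then show ?thesis
    using that by (auto simp: singular_boundary)
qed

text \<open>
  The chains are built one after another: \<open>c\<^sub>p \<plusminus> \<tau> c\<^sub>p\<close> is a cycle because \<open>\<tau>\<close> is an involution and the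
  signs alternate, so it bounds some \<open>c\<^bsub>p+1\<^esub>\<close>.
\<close>

lemma antipodal_chains_exist:
  fixes X :: "'a topology"
  assumes triv: "\<And>p. p < n \<Longrightarrow> trivial_group (reduced_homology_group (int p) X)"
    and "topspace X \<noteq> {}"
    and cont: "continuous_map X X \<tau>"
    and invol: "\<And>x. x \<in> topspace X \<Longrightarrow> \<tau> (\<tau> x) = x"
  shows "\<exists>c. antipodal_chains X \<tau> n c"
  using triv
proof (induction n)
  case 0
  obtain a where "a \<in> topspace X"
    using assms by blast
  then have "singular_simplex 0 X (restrict (\<lambda>_. a) (standard_simplex 0))"
    by (simp add: singular_simplex_def)
  then show ?case
    by (auto simp: antipodal_chains_def singular_chain_of
      intro!: exI[of _ "\<lambda>_. frag_of (restrict (\<lambda>_. a) (standard_simplex 0))"])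
next
  case (Suc p)
  then obtain c where c: "antipodal_chains X \<tau> p c"
    by auto
  define z where "z = c p + frag_cmul ((-1) ^ Suc p) (chain_map p \<tau> (c p))"
  have cp: "singular_chain p X (c p)"
    using c by (simp add: antipodal_chains_def)
  have z_chain: "singular_chain p X z"
    unfolding z_def
    by (intro singular_chain_add singular_chain_cmul singular_chain_chain_map[OF _ cont] cp)
  have z_cycle: "chain_boundary p z = 0"
  proof (cases p)
    case 0
    then show ?thesis by (simp add: chain_boundary_def)
  next
    case (Suc q)
    have cq: "singular_chain q X (c q)"
      and bd: "chain_boundary p (c p) = c q + frag_cmul ((-1) ^ p) (chain_map q \<tau> (c q))"
      using c Suc by (auto simp: antipodal_chains_def)
    have twice: "chain_map q \<tau> (chain_map q \<tau> (c q)) = c q"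
      using chain_map_compose[of q \<tau> \<tau>] chain_map_id_gen[OF cq, of "\<tau> \<circ> \<tau>"] invol
      by (simp add: fun_eq_iff)
    have "chain_boundary p (chain_map p \<tau> (c p)) = chain_map q \<tau> (chain_boundary p (c p))"
      using chain_boundary_chain_map[OF cp] Suc by simp
    then have "chain_boundary p (chain_map p \<tau> (c p)) =
        chain_map q \<tau> (c q) + frag_cmul ((-1) ^ p) (c q)"
      by (simp add: bd chain_map_add twice)
    moreover have "frag_cmul k b + frag_cmul (- k) b = 0" for k and b :: "'a chain"
      by (simp flip: frag_cmul_distrib)
    ultimately show ?thesis
      unfolding z_def chain_boundary_add chain_boundary_cmul bd
      by (simp add: frag_cmul_distrib2 flip: power_mult_distrib)
  qed
  have aug: "chain_map 0 (\<lambda>_. ()) z = 0" if "p = 0"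
  proof -
    have "chain_map 0 (\<lambda>_. ()) (chain_map 0 \<tau> (c 0)) = chain_map 0 (\<lambda>_. ()) (c 0)"
      using chain_map_compose[of 0 "\<lambda>_. ()" \<tau>] by (simp add: fun_eq_iff o_def)
    then show ?thesis
      using that by (simp add: z_def chain_map_diff)
  qed
  obtain d where d: "singular_chain (Suc p) X d" "chain_boundary (Suc p) d = z"
    using reduced_cycle_is_boundary[OF _ z_chain z_cycle aug] Suc.prems by blast
  have "antipodal_chains X \<tau> (Suc p) (c(Suc p := d))"
    using c d by (auto simp: antipodal_chains_def z_def le_Suc_eq less_Suc_eq)
  then show ?case by blast
qed

text \<open>
  A Lusternik--Schnirelmann theorem for spaces that are homologically trivial below degree \<open>n\<close>: the sets
  \<open>S\<^sub>i\<close> and their complements are exchanged by \<open>\<tau>\<close>, and however fine the cover, \<open>n\<close> such partitions can be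
  crossed simultaneously by one of its members.
\<close>

theorem open_cover_meets_both_sides:
  fixes X :: "'a topology" and S :: "nat \<Rightarrow> 'a set"
  assumes triv: "\<And>p. p < n \<Longrightarrow> trivial_group (reduced_homology_group (int p) X)"
    and ne: "topspace X \<noteq> {}"
    and cont: "continuous_map X X \<tau>"
    and invol: "\<And>x. x \<in> topspace X \<Longrightarrow> \<tau> (\<tau> x) = x"
    and S: "\<And>i x. i < n \<Longrightarrow> x \<in> topspace X \<Longrightarrow> \<tau> x \<in> S i \<longleftrightarrow> x \<notin> S i"
    and opn: "\<And>U. U \<in> \<U> \<Longrightarrow> openin X U"
    and cov: "topspace X \<subseteq> \<Union>\<U>"
  shows "\<exists>U\<in>\<U>. \<forall>i<n. U \<inter> S i \<noteq> {} \<and> U - S i \<noteq> {}"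
proof -
  obtain c where c: "antipodal_chains X \<tau> n c"
    using antipodal_chains_exist[OF triv ne cont invol] by blast
  then have "singular_chain n X (c n)"
    by (simp add: antipodal_chains_def)
  from sufficient_iterated_singular_subdivision_exists[OF opn cov this]
  obtain N where
    N: "\<And>M f. N \<le> M \<Longrightarrow> f \<in> Poly_Mapping.keys ((singular_subdivision n ^^ M) (c n)) \<Longrightarrow>
        \<exists>U\<in>\<U>. f \<in> standard_simplex n \<rightarrow> U"
    by metis
  define s :: "nat \<Rightarrow> 'a \<Rightarrow> int" where "s i x = of_bool (x \<in> S i)" for i x
  let ?c = "(singular_subdivision n ^^ N) (c n)"
  have "odd (eval_cochain (\<lambda>f. cup_coboundaries s n (simplex_vertices f)) ?c)"
    by (rule odd_eval_antipodal_chains[OF antipodal_chains_iterated_subdivision[OF c]])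
      (auto simp: s_def S)
  then have "eval_cochain (\<lambda>f. cup_coboundaries s n (simplex_vertices f)) ?c \<noteq> 0"
    by (rule contrapos_pn) simp
  then obtain f where f: "f \<in> Poly_Mapping.keys ?c" "cup_coboundaries s n (simplex_vertices f) \<noteq> 0"
    using eval_cochain_eq_0[of ?c "\<lambda>f. cup_coboundaries s n (simplex_vertices f)"] by blast
  obtain U where U: "U \<in> \<U>" "f \<in> standard_simplex n \<rightarrow> U"
    using N[OF order_refl f(1)] by blast
  \<comment> \<open>The \<open>i\<close>-th factor of the product is nonzero, so edge \<open>i\<close> of the small simplex crosses \<open>S i\<close>.\<close>
  have "U \<inter> S i \<noteq> {} \<and> U - S i \<noteq> {}" if "i < n" for i
  proof -
    have "s i (simplex_vertices f (Suc i)) \<noteq> s i (simplex_vertices f i)"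
      using f(2) that by (auto simp: cup_coboundaries_def)
    moreover have "simplex_vertices f (Suc i) \<in> U" "simplex_vertices f i \<in> U"
      using that by (auto intro!: simplex_vertices_in_image[OF _ U(2)])
    ultimately show ?thesis
      by (auto simp: s_def of_bool_def split: if_splits)
  qed
  then show ?thesis
    using U(1) by blast
qed

section \<open>Antipodal covers of the sphere and correspondences\<close>

lemma antipode_in_nsphere: "antipode x \<in> topspace (nsphere n) \<longleftrightarrow> x \<in> topspace (nsphere n)"
  by (simp add: antipode_def topspace_nsphere)

lemma antipode_antipode [simp]: "antipode (antipode x) = x"
  by (simp add: antipode_def)

lemma continuous_map_antipode: "continuous_map (nsphere n) (nsphere n) antipode"
proof -
  have "continuous_map (nsphere n) euclideanreal (\<lambda>x. - x k)" for k
    by (intro continuous_map_minus continuous_map_nsphere_projection)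
  then show ?thesis
    using antipode_in_nsphere[of _ n]
    by (subst (2) nsphere)
      (auto simp: continuous_map_in_subtopology continuous_map_componentwise_UNIV
        antipode_def topspace_nsphere)
qed

lemma linf_dist_antipode: "linf_dist n (antipode x) (antipode y) = linf_dist n x y"
  by (simp add: linf_dist_def antipode_def abs_minus_commute)

lemma openin_linf_ball: "openin (nsphere n) {y \<in> topspace (nsphere n). linf_dist n x y < r}"
proof -
  have "{y \<in> topspace (nsphere n). linf_dist n x y < r} =
      topspace (nsphere n) \<inter> (\<Inter>i\<in>{..n}. {y \<in> topspace (nsphere n). \<bar>x i - y i\<bar> \<in> {..<r}})"
    by (auto simp: linf_dist_def)
  moreover have "openin (nsphere n) {y \<in> topspace (nsphere n). \<bar>x i - y i\<bar> \<in> {..<r}}" for i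
    by (rule openin_continuous_map_preimage[where Y = euclideanreal])
      (auto intro!: continuous_map_real_abs continuous_map_diff continuous_map_nsphere_projection)
  ultimately show ?thesis
    by (auto intro!: openin_Int openin_INT)
qed

lemma nsphere_large_coordinate:
  assumes "x \<in> topspace (nsphere m)"
  obtains i where "i \<le> m" "1 / sqrt (real (m + 1)) \<le> \<bar>x i\<bar>"
proof -
  have "\<exists>i\<le>m. 1 / sqrt (real (m + 1)) \<le> \<bar>x i\<bar>"
  proof (rule ccontr)
    assume "\<not> ?thesis"
    then have "\<bar>x i\<bar> < 1 / sqrt (real (m + 1))" if "i \<le> m" for i
      using that not_le by blast
    then have "\<bar>x i\<bar>\<^sup>2 < (1 / sqrt (real (m + 1)))\<^sup>2" if "i \<le> m" for i
      using that by (intro power_strict_mono) auto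
    then have "(x i)\<^sup>2 < 1 / real (m + 1)" if "i \<le> m" for i
      using that by (simp add: power_divide)
    then have "(\<Sum>i\<le>m. (x i)\<^sup>2) < (\<Sum>i\<le>m. 1 / real (m + 1))"
      by (intro sum_strict_mono) auto
    then show False
      using assms by (simp add: topspace_nsphere)
  qed
  then show ?thesis using that by blast
qed

text \<open>
  A set of representatives for the antipodal pairs, here by the sign of the first nonzero coordinate. It
  supplies the values of the functions \<open>s\<^sub>i\<close> away from \<open>A\<^sub>i\<close> and \<open>-A\<^sub>i\<close>, where they only have to be
  antisymmetric.
\<close>

lemma antisymmetric_half_nsphere:
  "\<exists>H. \<forall>x\<in>topspace (nsphere n). antipode x \<in> H \<longleftrightarrow> x \<notin> H"
proof -
  define H :: "(nat \<Rightarrow> real) set" where "H = {x. x (LEAST i. x i \<noteq> 0) > 0}"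
  have "antipode x \<in> H \<longleftrightarrow> x \<notin> H" if "x \<in> topspace (nsphere n)" for x
  proof -
    have "\<exists>i. x i \<noteq> 0"
    proof (rule ccontr)
      assume "\<not> ?thesis"
      then show False using that by (simp add: topspace_nsphere)
    qed
    then have "x (LEAST i. x i \<noteq> 0) \<noteq> 0"
      by (rule LeastI_ex)
    then show ?thesis
      by (auto simp: H_def antipode_def)
  qed
  then show ?thesis by blast
qed

text \<open>
  If \<open>A\<^sub>i\<close> and \<open>-A\<^sub>i\<close> were \<open>\<delta>\<close> apart for all \<open>i\<close>, their open \<open>\<delta>/2\<close>-neighbourhoods would be disjoint, and
  one could choose \<open>S\<^sub>i\<close> to contain the first, to miss the second and to be exchanged with its
  complement by the antipodal map. A ball of radius \<open>\<delta>/2\<close> has its centre in some \<open>A\<^sub>i\<close> or \<open>-A\<^sub>i\<close>, hence lies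
  on one side of \<open>S\<^sub>i\<close>, although one such ball has to meet both sides of all the \<open>m + 1 \<le> n\<close> sets.
\<close>

lemma antipodal_sets_come_close:
  assumes "m < n" and "\<delta> > 0"
    and sub: "\<And>i. i \<le> m \<Longrightarrow> A i \<subseteq> topspace (nsphere n)"
    and cov: "\<And>y. y \<in> topspace (nsphere n) \<Longrightarrow> \<exists>i\<le>m. y \<in> A i \<or> antipode y \<in> A i"
  shows "\<exists>i\<le>m. \<exists>a\<in>A i. \<exists>b\<in>A i. linf_dist n a (antipode b) < \<delta>"
proof (rule ccontr)
  assume far: "\<not> ?thesis"
  interpret Metric_space "topspace (nsphere n)" "linf_dist n"
    by (rule Metric_space_linf)
  define near where "near i = {y \<in> topspace (nsphere n). \<exists>a\<in>A i. linf_dist n a y < \<delta> / 2}" for i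
  obtain H where H: "\<forall>x\<in>topspace (nsphere n). antipode x \<in> H \<longleftrightarrow> x \<notin> H"
    using antisymmetric_half_nsphere[of n] ..
  define S where "S i = {y. y \<in> near i \<or> antipode y \<notin> near i \<and> y \<in> H}" for i
  have disj: "antipode y \<notin> near i" if y: "y \<in> near i" "i \<le> m" for i y
  proof
    assume y': "antipode y \<in> near i"
    obtain a b where ab: "a \<in> A i" "linf_dist n a y < \<delta> / 2"
      "b \<in> A i" "linf_dist n b (antipode y) < \<delta> / 2" "y \<in> topspace (nsphere n)"
      using y(1) y' unfolding near_def by blast
    have "linf_dist n y (antipode b) < \<delta> / 2"
      using ab(4) linf_dist_antipode[of n b "antipode y"] commute[of y "antipode b"] by simp
    moreover have "linf_dist n a (antipode b) \<le> linf_dist n a y + linf_dist n y (antipode b)"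
      using ab(1,3,5) sub[OF y(2)] by (intro triangle) (auto simp: antipode_in_nsphere)
    ultimately have "linf_dist n a (antipode b) < \<delta>"
      using ab(2) by linarith
    then show False using far ab y(2) by blast
  qed
  let ?ball = "\<lambda>x. {y \<in> topspace (nsphere n). linf_dist n x y < \<delta> / 2}"
  obtain U where "U \<in> ?ball ` topspace (nsphere n)"
    and U: "\<forall>i<Suc m. U \<inter> S i \<noteq> {} \<and> U - S i \<noteq> {}"
  proof -
    have "\<exists>U\<in>?ball ` topspace (nsphere n). \<forall>i<Suc m. U \<inter> S i \<noteq> {} \<and> U - S i \<noteq> {}"
    proof (rule open_cover_meets_both_sides)
      show "trivial_group (reduced_homology_group (int p) (nsphere n))" if "p < Suc m" for p
        using that \<open>m < n\<close> by (simp add: trivial_reduced_homology_group_nsphere)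
      show "topspace (nsphere n) \<noteq> {}"
        using in_topspace_nsphere by blast
      show "continuous_map (nsphere n) (nsphere n) antipode"
        by (rule continuous_map_antipode)
      show "antipode y \<in> S i \<longleftrightarrow> y \<notin> S i" if "i < Suc m" "y \<in> topspace (nsphere n)" for i y
        using disj[of y i] disj[of "antipode y" i] bspec[OF H that(2)] that(1) by (auto simp: S_def)
      show "topspace (nsphere n) \<subseteq> \<Union> (?ball ` topspace (nsphere n))"
      proof
        fix y
        assume "y \<in> topspace (nsphere n)"
        then have "y \<in> ?ball y"
          using \<open>\<delta> > 0\<close> by simp
        then show "y \<in> \<Union> (?ball ` topspace (nsphere n))"
          using \<open>y \<in> topspace (nsphere n)\<close> by blast
      qed
      show "openin (nsphere n) U" if "U \<in> ?ball ` topspace (nsphere n)" for U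
        using that openin_linf_ball by blast
    qed simp
    then show ?thesis using that by blast
  qed
  then obtain x where x: "x \<in> topspace (nsphere n)" "U = ?ball x"
    by blast
  have both: "?ball x \<inter> S i \<noteq> {}" "?ball x - S i \<noteq> {}" if "i \<le> m" for i
    using U[rule_format, of i] that unfolding x(2) less_Suc_eq_le by blast+
  obtain i where i: "i \<le> m" "x \<in> A i \<or> antipode x \<in> A i"
    using cov[OF x(1)] by blast
  from i(2) show False
  proof
    assume "x \<in> A i"
    then have "?ball x \<subseteq> near i"
      unfolding near_def by blast
    also have "\<dots> \<subseteq> S i"
      unfolding S_def by blast
    finally show False
      using both(2)[OF i(1)] by blast
  next
    assume Ax: "antipode x \<in> A i"
    have "y \<notin> S i" if "y \<in> ?ball x" for y
    proof -
      have "linf_dist n (antipode x) (antipode y) < \<delta> / 2" "antipode y \<in> topspace (nsphere n)"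
        using that by (simp_all add: linf_dist_antipode antipode_in_nsphere)
      then have "antipode y \<in> near i"
        using Ax unfolding near_def by blast
      then show ?thesis
        using disj[of y i] i(1) unfolding S_def by blast
    qed
    then show False
      using both(1)[OF i(1)] by blast
  qed
qed

lemma distortion_z2_correspondence_ge:
  assumes "m < n"
    and R: "R \<in> z2_correspondences (linf_sphere m) antipode (linf_sphere n) antipode"
  shows "ennreal (2 / sqrt (real (m + 1))) \<le> distortion (linf_sphere m) (linf_sphere n) R"
proof (rule ccontr)
  define r where "r = 1 / sqrt (real (m + 1))"
  assume "\<not> ?thesis"
  then have less: "distortion (linf_sphere m) (linf_sphere n) R < ennreal (2 * r)"
    by (simp add: r_def)
  define D where "D = enn2real (distortion (linf_sphere m) (linf_sphere n) R)"
  have D: "distortion (linf_sphere m) (linf_sphere n) R = ennreal D"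
    unfolding D_def using less by (metis ennreal_enn2real ennreal_less_top order_less_trans)
  have "r > 0" by (simp add: r_def)
  then have "D < 2 * r"
    using less unfolding D by (simp add: ennreal_less_iff D_def)
  have dist: "\<bar>linf_dist m x x' - linf_dist n y y'\<bar> \<le> D" if "(x, y) \<in> R" "(x', y') \<in> R" for x y x' y'
  proof -
    have "ennreal \<bar>linf_dist m x x' - linf_dist n y y'\<bar> \<le> distortion (linf_sphere m) (linf_sphere n) R"
      unfolding distortion_def by (rule SUP_upper2[of "((x, y), (x', y'))"]) (use that in auto)
    then show ?thesis
      unfolding D by (simp add: D_def)
  qed
  have Rsub: "R \<subseteq> topspace (nsphere m) \<times> topspace (nsphere n)"
    and Rsnd: "snd ` R = topspace (nsphere n)"
    and Ranti: "\<And>x y. (x, y) \<in> R \<Longrightarrow> (antipode x, antipode y) \<in> R"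
    using R by (auto simp: z2_correspondences_def)
  \<comment> \<open>By equivariance of \<open>R\<close>, the antipodal image of \<open>A i\<close> is given by the condition \<open>x i \<le> - r\<close>.\<close>
  define A where "A i = {y. \<exists>x. (x, y) \<in> R \<and> r \<le> x i}" for i
  have "\<exists>i\<le>m. \<exists>a\<in>A i. \<exists>b\<in>A i. linf_dist n a (antipode b) < 2 * r - D"
  proof (rule antipodal_sets_come_close[OF \<open>m < n\<close>])
    show "A i \<subseteq> topspace (nsphere n)" for i
      using Rsub by (auto simp: A_def)
    fix y
    assume "y \<in> topspace (nsphere n)"
    then obtain x where x: "(x, y) \<in> R"
      using Rsnd by force
    then obtain i where i: "i \<le> m" "r \<le> \<bar>x i\<bar>"
      using nsphere_large_coordinate[of x m] Rsub unfolding r_def by blast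
    then have "y \<in> A i \<or> antipode y \<in> A i"
      using x Ranti[OF x] by (auto simp: A_def antipode_def abs_if split: if_splits)
    then show "\<exists>i\<le>m. y \<in> A i \<or> antipode y \<in> A i"
      using i by blast
  qed (use \<open>D < 2 * r\<close> in simp)
  then obtain i a b x x' where i: "i \<le> m" and ab: "linf_dist n a (antipode b) < 2 * r - D"
    and x: "(x, a) \<in> R" "r \<le> x i" and x': "(x', b) \<in> R" "r \<le> x' i"
    by (auto simp: A_def)
  have "2 * r \<le> linf_dist m x (antipode x')"
    using linf_dist_ge[OF i, of x "antipode x'"] x(2) x'(2) by (simp add: antipode_def)
  then show False
    using dist[OF x(1) Ranti[OF x'(1)]] ab by linarith
qed

theorem corollary7p3:
  fixes m n :: nat
  assumes "m < n"
  shows "GH_dist_Z2 (linf_sphere m) antipode (linf_sphere n) antipode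
           \<ge> ennreal (1 / sqrt (real (m + 1)))"
proof -
  have half: "(1 / 2 :: ennreal) = ennreal (1 / 2)"
    using ennreal_divide_numeral[OF zero_le_one, of "num.Bit0 num.One"] unfolding ennreal_1 .
  have "ennreal (1 / sqrt (real (m + 1))) = (1 / 2) * ennreal (2 / sqrt (real (m + 1)))"
    unfolding half by (subst ennreal_mult[symmetric]) auto
  also have "\<dots> \<le> GH_dist_Z2 (linf_sphere m) antipode (linf_sphere n) antipode"
    unfolding GH_dist_Z2_def
    by (intro mult_left_mono INF_greatest distortion_z2_correspondence_ge assms) auto
  finally show ?thesis .
qed

end
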